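(* Let $n\ge 1$, let $c_0,\ldots,c_n$ be nonnegative integers, and let $A_1,\ldots,A_n$ be a sequence of matrices $A_i\in\mathbb{R}^{c_{i-1}\times c_i}$ which define a complex, i.e. $A_iA_{i+1}=0$ for $1\le i\le n-1$. Let $r_i=\operatorname{rank}A_i$ for $1\le i\le n$, $r_0=r_{n+1}=0$, and $h_i=c_i-(r_i+r_{i+1})$ for $0\le i\le n$. Then there exist sequences $U_0,\ldots,U_n$ and $\Sigma_1,\ldots,\Sigma_n$ of orthogonal and diagonal matrices, respectively, with $U_i\in\mathbb{R}^{c_i\times c_i}$ and $\Sigma_i\in\mathbb{R}^{r_i\times r_i}$, such that for every $i=1,\ldots,n$ $$U_{i-1}^t\,A_i\,U_i=\begin{pmatrix}0&0&0\\ \Sigma_i&0&0\\ 0&0&0\end{pmatrix},$$ where the block rows have sizes $r_{i-1},r_i,h_{i-1}$ (in this order), the block columns have sizes $r_i,r_{i+1},h_i$ (in this order), and all diagonal entries of $\Sigma_i$ are strictly positive. Moreover, if $r_i>0$ for every $i=1,\ldots,n$ and $h_i>0$ for at least one $i\in\{0,\ldots,n\}$, then the orthogonal matrices $U_i$ can be chosen such that $\det U_i=1$ for all $i=0,\ldots,n$.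
   Context: The matrices define a finite complex of real vector spaces $0\leftarrow\mathbb{R}^{c_0}\xleftarrow{A_1}\mathbb{R}^{c_1}\leftarrow\cdots\xleftarrow{A_n}\mathbb{R}^{c_n}\leftarrow 0$, with the convention that $A_0$ and $A_{n+1}$ are zero maps (so $r_0=r_{n+1}=0$). The number $h_i$ is the dimension of the $i$-th homology $\ker A_i/\operatorname{image}A_{i+1}$. Blocks of size zero are empty. *)

theory Defs
  imports "Jordan_Normal_Form.DL_Rank"
begin

abbreviation mat_rank :: "real mat \<Rightarrow> nat" where
  "mat_rank A \<equiv> vec_space.rank (dim_row A) A"

(* orthogonal_mat of Jordan_Normal_Form only requires pairwise orthogonal nonzero columns;
   orthogonal matrices in the usual sense have orthonormal columns. *)
definition orthonormal_mat :: "nat \<Rightarrow> real mat \<Rightarrow> bool" where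
  "orthonormal_mat m U \<longleftrightarrow> U \<in> carrier_mat m m \<and> transpose_mat U * U = 1\<^sub>m m"

(* The block matrix
     B11 B12 B13
     B21 B22 B23
     B31 B32 B33
   whose dimensions are read off the diagonal blocks; blocks may have zero rows or columns.
   The lower left argument is B31 B32 side by side: Jordan_Normal_Form has only @\<^sub>r, which stacks. *)
definition nine_block_mat ::
  "'a::zero mat \<Rightarrow> 'a mat \<Rightarrow> 'a mat \<Rightarrow> 'a mat \<Rightarrow> 'a mat \<Rightarrow> 'a mat \<Rightarrow> 'a mat \<Rightarrow> 'a mat \<Rightarrow> 'a mat \<Rightarrow> 'a mat"
  where
  "nine_block_mat B11 B12 B13 B21 B22 B23 B31 B32 B33 =
     four_block_mat
       (four_block_mat B11 B12 B21 B22)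
       (B13 @\<^sub>r B23)
       (four_block_mat B31 B32 (0\<^sub>m 0 (dim_col B31)) (0\<^sub>m 0 (dim_col B32)))
       B33"

definition complex_svd ::
  "nat \<Rightarrow> (nat \<Rightarrow> nat) \<Rightarrow> (nat \<Rightarrow> nat) \<Rightarrow> (nat \<Rightarrow> nat) \<Rightarrow> (nat \<Rightarrow> real mat) \<Rightarrow>
   (nat \<Rightarrow> real mat) \<Rightarrow> (nat \<Rightarrow> real mat) \<Rightarrow> bool"
  where
  "complex_svd n c r h A U \<Sigma> \<longleftrightarrow>
     (\<forall>i\<in>{0..n}. orthonormal_mat (c i) (U i)) \<and>
     (\<forall>i\<in>{1..n}. \<Sigma> i \<in> carrier_mat (r i) (r i) \<and> diagonal_mat (\<Sigma> i) \<and>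
        (\<forall>k<r i. \<Sigma> i $$ (k, k) > 0)) \<and>
     (\<forall>i\<in>{1..n}. transpose_mat (U (i - 1)) * A i * U i =
        nine_block_mat
          (0\<^sub>m (r (i - 1)) (r i)) (0\<^sub>m (r (i - 1)) (r (i + 1))) (0\<^sub>m (r (i - 1)) (h i))
          (\<Sigma> i)                 (0\<^sub>m (r i) (r (i + 1)))       (0\<^sub>m (r i) (h i))
          (0\<^sub>m (h (i - 1)) (r i)) (0\<^sub>m (h (i - 1)) (r (i + 1))) (0\<^sub>m (h (i - 1)) (h i)))"

end

theory Submission
  imports Defs "Jordan_Normal_Form.Spectral_Radius"
begin

text \<open>A reduced singular value decomposition of each \<open>A i\<close> provides right singular vectors \<open>v i\<close> in
  \<open>R^(c i)\<close> and left singular vectors \<open>u i\<close> in \<open>R^(c (i - 1))\<close>. Because \<open>A i * A (i + 1) = 0\<close>, the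
  row space of \<open>A i\<close> is orthogonal to the column space of \<open>A (i + 1)\<close>, so \<open>v i\<close> and \<open>u (i + 1)\<close>
  together are orthonormal in \<open>R^(c i)\<close>; any completion to an orthonormal basis gives the columns
  of \<open>U i\<close>. Flipping the signs of a pair \<open>v i k\<close>, \<open>u i k\<close> changes the signs of both \<open>det (U (i - 1))\<close>
  and \<open>det (U i)\<close>, so that determinants \<open>-1\<close> can be moved along the complex to an index with
  \<open>h i > 0\<close>, where a completing column is free to absorb the remaining sign.\<close>

subsection \<open>Orthonormal families\<close>

lemma real_scalar_prod_self:
  fixes v :: "real vec"
  shows "v \<bullet> v \<ge> 0" and "v \<in> carrier_vec n \<Longrightarrow> v \<bullet> v = 0 \<longleftrightarrow> v = 0\<^sub>v n"
proof -
  have c: "conjugate v = v" by (auto intro!: eq_vecI)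
  show "v \<bullet> v \<ge> 0" using conjugate_square_ge_0_vec[of v] by (simp add: c)
  show "v \<in> carrier_vec n \<Longrightarrow> v \<bullet> v = 0 \<longleftrightarrow> v = 0\<^sub>v n"
    using conjugate_square_eq_0_vec[of v n] by (simp add: c)
qed

text \<open>Values at indices from \<open>k\<close> on are unconstrained, so a family is lengthened
  by a function update and shortened by lowering \<open>k\<close>.\<close>

definition orthonormal_family :: "nat \<Rightarrow> nat \<Rightarrow> (nat \<Rightarrow> real vec) \<Rightarrow> bool" where
  "orthonormal_family n k f \<longleftrightarrow>
     (\<forall>i<k. f i \<in> carrier_vec n) \<and> (\<forall>i<k. \<forall>j<k. f i \<bullet> f j = (if i = j then 1 else 0))"

lemma orthonormal_familyD:
  assumes "orthonormal_family n k f"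
  shows "i < k \<Longrightarrow> f i \<in> carrier_vec n"
    and "i < k \<Longrightarrow> j < k \<Longrightarrow> f i \<bullet> f j = (if i = j then 1 else 0)"
  using assms unfolding orthonormal_family_def by auto

lemma orthonormal_family_mono:
  "orthonormal_family n k f \<Longrightarrow> l \<le> k \<Longrightarrow> orthonormal_family n l f"
  unfolding orthonormal_family_def by auto

lemma orthonormal_family_Suc:
  assumes f: "orthonormal_family n k f" and v: "v \<in> carrier_vec n" "v \<bullet> v = 1"
    and orth: "\<And>j. j < k \<Longrightarrow> f j \<bullet> v = 0"
  shows "orthonormal_family n (Suc k) (f(k := v))"
proof -
  have "v \<bullet> f j = 0" if "j < k" for j
    using orth[OF that] comm_scalar_prod[OF v(1) orthonormal_familyD(1)[OF f that]] by simp
  then show ?thesis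
    using f v orth unfolding orthonormal_family_def by (auto simp: less_Suc_eq)
qed

section \<open>Orthonormal families as matrix columns\<close>

definition family_mat :: "nat \<Rightarrow> nat \<Rightarrow> (nat \<Rightarrow> 'a vec) \<Rightarrow> 'a mat" where
  "family_mat n k f = mat n k (\<lambda>(i, j). f j $ i)"

lemma family_mat_carrier [simp]: "family_mat n k f \<in> carrier_mat n k"
  unfolding family_mat_def by simp

lemma family_mat_dim [simp]:
  "dim_row (family_mat n k f) = n" "dim_col (family_mat n k f) = k"
  unfolding family_mat_def by simp_all

lemma col_family_mat [simp]:
  "j < k \<Longrightarrow> f j \<in> carrier_vec n \<Longrightarrow> col (family_mat n k f) j = f j"
  unfolding family_mat_def by (intro eq_vecI) auto

lemma orthonormal_mat_family_mat:
  assumes "orthonormal_family n n f"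
  shows "orthonormal_mat n (family_mat n n f)"
  unfolding orthonormal_mat_def
  by (auto intro!: eq_matI simp: orthonormal_familyD[OF assms])

lemma orthonormal_mat_right_inverse:
  assumes "orthonormal_mat n U"
  shows "U * transpose_mat U = 1\<^sub>m n"
  using assms mat_mult_left_right_inverse[of "transpose_mat U" n U]
  unfolding orthonormal_mat_def by auto

text \<open>If \<open>U\<close> has the columns \<open>f j\<close>, orthogonality says
  \<open>U^T w = 0\<close>, and \<open>U U^T = 1\<close> then forces \<open>w = 0\<close>. Vector
  identities are later proved by testing their difference against such a basis.\<close>

lemma orthonormal_family_complete:
  assumes f: "orthonormal_family n n f" and w: "w \<in> carrier_vec n"
    and orth: "\<And>j. j < n \<Longrightarrow> f j \<bullet> w = 0"
  shows "w = 0\<^sub>v n"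
proof -
  let ?U = "family_mat n n f"
  have "transpose_mat ?U *\<^sub>v w = 0\<^sub>v n"
    by (rule eq_vecI) (auto simp: orthonormal_familyD[OF f] orth)
  moreover have "w = (?U * transpose_mat ?U) *\<^sub>v w"
    using orthonormal_mat_right_inverse[OF orthonormal_mat_family_mat[OF f]] w by simp
  ultimately show ?thesis
    using w by (subst (asm) assoc_mult_mat_vec[of _ n n _ n]) auto
qed

section \<open>Extension to an orthonormal basis\<close>

lemma ex_unit_scaling:
  fixes v :: "real vec"
  assumes v: "v \<in> carrier_vec n" "v \<noteq> 0\<^sub>v n"
  shows "\<exists>a. (a \<cdot>\<^sub>v v) \<bullet> (a \<cdot>\<^sub>v v) = 1"
proof -
  have "v \<bullet> v > 0" using real_scalar_prod_self[of v] v by (metis less_eq_real_def)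
  then have "(inverse (sqrt (v \<bullet> v)) \<cdot>\<^sub>v v) \<bullet> (inverse (sqrt (v \<bullet> v)) \<cdot>\<^sub>v v) = 1"
    using v by (simp add: field_simps flip: power2_eq_square)
  then show ?thesis by blast
qed

text \<open>The \<open>k\<close> orthogonality conditions, padded by zero rows, form a singular square system.\<close>

lemma ex_unit_orthogonal:
  assumes f: "orthonormal_family n k f" and k: "k < n"
  shows "\<exists>v \<in> carrier_vec n. v \<bullet> v = 1 \<and> (\<forall>j<k. f j \<bullet> v = 0)"
proof -
  define c where "c i = (if i < k then f i else 0\<^sub>v n)" for i
  \<comment> \<open>Row \<open>k\<close> exists because \<open>k < n\<close>. It is zero in
    \<open>c\<close> already; the case distinction only exhibits the zero row in the form that
    \<open>det_row_0\<close> expects.\<close>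
  define B where "B = mat\<^sub>r n n (\<lambda>i. if i = k then 0\<^sub>v n else c i)"
  have c: "c i \<in> carrier_vec n" for i
    unfolding c_def using orthonormal_familyD[OF f] by auto
  have "det B = 0"
    unfolding B_def by (rule det_row_0[OF k]) (use c in auto)
  moreover have B: "B \<in> carrier_mat n n" unfolding B_def by simp
  ultimately obtain v where v: "v \<in> carrier_vec n" "v \<noteq> 0\<^sub>v n" "B *\<^sub>v v = 0\<^sub>v n"
    using det_0_iff_vec_prod_zero_field by blast
  have fv: "f j \<bullet> v = 0" if "j < k" for j
  proof -
    have "(B *\<^sub>v v) $ j = row B j \<bullet> v" using B that k by simp
    also have "row B j = f j"
      unfolding B_def using that k c[of j] by (subst row_mat_of_row_fun) (auto simp: c_def)
    finally show ?thesis using v that k by simp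
  qed
  obtain a where a: "(a \<cdot>\<^sub>v v) \<bullet> (a \<cdot>\<^sub>v v) = 1" using ex_unit_scaling v by blast
  show ?thesis
  proof (intro bexI[of _ "a \<cdot>\<^sub>v v"] conjI allI impI a)
    fix j assume j: "j < k"
    show "f j \<bullet> (a \<cdot>\<^sub>v v) = 0"
      using fv[OF j] v(1) orthonormal_familyD(1)[OF f j] by simp
  qed (use v in auto)
qed

text \<open>The induction descends from the full length \<open>n\<close>: one unit vector is
  appended to \<open>m < n\<close> vectors, and the result for length \<open>m + 1\<close> is
  applied to the longer family. Hence \<open>f\<close> has to stay arbitrary.\<close>

lemma orthonormal_family_extend:
  assumes "k \<le> n" and "orthonormal_family n k f"
  shows "\<exists>g. orthonormal_family n n g \<and> (\<forall>j<k. g j = f j)"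
  using assms
proof (induction arbitrary: f rule: inc_induct)
  case base
  then show ?case by auto
next
  case (step m)
  obtain v where "v \<in> carrier_vec n" "v \<bullet> v = 1" "\<forall>j<m. f j \<bullet> v = 0"
    using ex_unit_orthogonal[OF step.prems step.hyps(2)] by blast
  then have "orthonormal_family n (Suc m) (f(m := v))"
    using orthonormal_family_Suc[OF step.prems] by blast
  from step.IH[OF this] show ?case by (metis fun_upd_other less_SucI nat_neq_iff)
qed

text \<open>If \<open>n < k\<close>, then \<open>f n\<close> is orthogonal to the \<open>n\<close>
  vectors before it, which already form a basis, so it vanishes and cannot have length one.\<close>

lemma orthonormal_family_le:
  assumes f: "orthonormal_family n k f"
  shows "k \<le> n"
proof (rule ccontr)
  assume "\<not> k \<le> n"
  then have n: "n < k" by simp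
  have "f n = 0\<^sub>v n"
    by (rule orthonormal_family_complete[OF orthonormal_family_mono[OF f]])
      (use n orthonormal_familyD[OF f] in auto)
  then show False using orthonormal_familyD(2)[OF f n n] by simp
qed

subsection \<open>Spectral theorem for real symmetric matrices\<close>

text \<open>The product is bilinear, without conjugation, and the coefficients are general, so that
  the fact serves both a real matrix and its complexification.\<close>

lemma symmetric_transfer:
  fixes S :: "'a :: comm_semiring_0 mat"
  assumes "S \<in> carrier_mat n n" "transpose_mat S = S" "x \<in> carrier_vec n" "y \<in> carrier_vec n"
  shows "(S *\<^sub>v y) \<bullet> x = y \<bullet> (S *\<^sub>v x)"
  using transpose_vec_mult_scalar[OF assms(1,3,4)] assms(2) by simp

text \<open>A complex eigenvalue \<open>l\<close> exists, and symmetry yields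
  \<open>l * (v \<bullet>c v) = cnj l * (v \<bullet>c v)\<close>, so \<open>l\<close> is
  real.\<close>

lemma symmetric_ex_eigenvector:
  fixes S :: "real mat"
  assumes S: "S \<in> carrier_mat n n" and sym: "transpose_mat S = S" and n: "n > 0"
  shows "\<exists>v e. v \<in> carrier_vec n \<and> v \<noteq> 0\<^sub>v n \<and> S *\<^sub>v v = e \<cdot>\<^sub>v v"
proof -
  define C where "C = map_mat complex_of_real S"
  have C: "C \<in> carrier_mat n n" unfolding C_def using S by simp
  have symC: "transpose_mat C = C" unfolding C_def using sym by (metis map_mat_transpose)
  obtain l where l: "eigenvalue C l"
    using spectrum_non_empty[OF C n] unfolding spectrum_def by auto
  then obtain v where v: "v \<in> carrier_vec n" "v \<noteq> 0\<^sub>v n" "C *\<^sub>v v = l \<cdot>\<^sub>v v"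
    unfolding eigenvalue_def eigenvector_def using C by auto
  have cv: "conjugate v \<in> carrier_vec n" using v by simp
  \<comment> \<open>The entries of \<open>C\<close> are real, so \<open>C\<close> commutes with
    conjugation.\<close>
  have "C *\<^sub>v conjugate v = conjugate (C *\<^sub>v v)"
    using v(1) C by (intro eq_vecI) (auto simp: scalar_prod_def C_def)
  also have "\<dots> = cnj l \<cdot>\<^sub>v conjugate v"
    using v by (intro eq_vecI) auto
  finally have Ccv: "C *\<^sub>v conjugate v = cnj l \<cdot>\<^sub>v conjugate v" .
  have "l * (v \<bullet>c v) = (C *\<^sub>v v) \<bullet>c v" using v cv by simp
  also have "\<dots> = v \<bullet> (C *\<^sub>v conjugate v)"
    using symmetric_transfer[OF C symC cv v(1)] .
  also have "\<dots> = cnj l * (v \<bullet>c v)" using Ccv v cv by simp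
  finally have "l = cnj l" using v conjugate_square_eq_0_vec[OF v(1)] by simp
  then have re: "l = complex_of_real (Re l)" by (simp add: complex_eq_iff)
  \<comment> \<open>The complex eigenvector need not be real. Instead \<open>Re l\<close> is
    recognised as a root of the real characteristic polynomial, which provides a real
    eigenvector.\<close>
  have "poly (char_poly C) l = 0" using l eigenvalue_root_char_poly[OF C] by simp
  then have "poly (map_poly complex_of_real (char_poly S)) (complex_of_real (Re l)) = 0"
    unfolding C_def of_real_hom.char_poly_hom[OF S] using re by simp
  then have "poly (char_poly S) (Re l) = 0" by simp
  then have "eigenvalue S (Re l)" using eigenvalue_root_char_poly[OF S] by simp
  then show ?thesis unfolding eigenvalue_def eigenvector_def using S by auto
qed

text \<open>Compressing \<open>S\<close> to the orthogonal complement of the eigenvectors found so far gives a smaller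
  symmetric matrix; its eigenvectors are eigenvectors of \<open>S\<close>, as \<open>S\<close> preserves the complement.\<close>

lemma symmetric_next_eigenvector:
  fixes S :: "real mat"
  assumes S: "S \<in> carrier_mat n n" and sym: "transpose_mat S = S"
    and f: "orthonormal_family n k f" and k: "k < n"
    and eig: "\<And>j. j < k \<Longrightarrow> S *\<^sub>v f j = d j \<cdot>\<^sub>v f j"
  shows "\<exists>v e. v \<in> carrier_vec n \<and> v \<bullet> v = 1 \<and> (\<forall>j<k. f j \<bullet> v = 0) \<and> S *\<^sub>v v = e \<cdot>\<^sub>v v"
proof -
  obtain g where g: "orthonormal_family n n g" and gf: "\<And>j. j < k \<Longrightarrow> g j = f j"
    using orthonormal_family_extend[OF _ f] k by auto
  note gD = orthonormal_familyD[OF g]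
  define m where "m = n - k"
  define W where "W = family_mat n m (\<lambda>j. g (k + j))"
  have W: "W \<in> carrier_mat n m" unfolding W_def by simp
  have colW: "col W j = g (k + j)" if "j < m" for j
    unfolding W_def using that gD by (subst col_family_mat) (auto simp: m_def)
  let ?T = "transpose_mat W * S * W"
  have T: "?T \<in> carrier_mat m m" using W S by simp
  have "transpose_mat ?T = transpose_mat W * (transpose_mat S * W)"
    using W S by (subst transpose_mult[of _ m n _ m]) (auto simp: transpose_mult[of _ m n _ n])
  then have "transpose_mat ?T = ?T" using sym W S by simp
  then obtain x e where x: "x \<in> carrier_vec m" "x \<noteq> 0\<^sub>v m" and ex: "?T *\<^sub>v x = e \<cdot>\<^sub>v x"
    using symmetric_ex_eigenvector[OF T] k unfolding m_def by auto
  define w where "w = W *\<^sub>v x"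
  have w: "w \<in> carrier_vec n" unfolding w_def using W x(1) by simp
  have Sw: "S *\<^sub>v w \<in> carrier_vec n" using S w by simp
  have WW: "transpose_mat W * W = 1\<^sub>m m"
    using W by (intro eq_matI) (auto simp: colW gD m_def)
  have Wtw: "transpose_mat W *\<^sub>v w = x"
    using W x WW unfolding w_def by (subst assoc_mult_mat_vec[symmetric, of _ m n _ m]) auto
  have w0: "w \<noteq> 0\<^sub>v n"
  proof
    assume "w = 0\<^sub>v n"
    then have "transpose_mat W *\<^sub>v w = 0\<^sub>v m" using W by auto
    then show False using Wtw x by simp
  qed
  have WtSw: "transpose_mat W *\<^sub>v (S *\<^sub>v w) = e \<cdot>\<^sub>v x"
    using ex W S x unfolding w_def by (simp add: assoc_mult_mat_vec[of _ m n _ m]  assoc_mult_mat_vec[of _ m n _ n])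
  have fw: "f j \<bullet> w = 0" if j: "j < k" for j
  proof -
    have fj: "f j \<in> carrier_vec n" using orthonormal_familyD[OF f] j by simp
    have "transpose_mat W *\<^sub>v f j = 0\<^sub>v m"
      using W by (intro eq_vecI) (use j k gD gf[OF j, symmetric] in \<open>auto simp: colW m_def\<close>)
    then show ?thesis
      using transpose_vec_mult_scalar[OF W x(1) fj] x unfolding w_def by simp
  qed
  \<comment> \<open>The difference is tested against the whole basis \<open>g\<close>. The first
    \<open>k\<close> members are eigenvectors of \<open>S\<close> orthogonal to \<open>w\<close>;
    the others are the columns of \<open>W\<close>, where the eigenvalue equation of the compression
    applies.\<close>
  have "S *\<^sub>v w - e \<cdot>\<^sub>v w = 0\<^sub>v n"
  proof (rule orthonormal_family_complete[OF g])
    show "S *\<^sub>v w - e \<cdot>\<^sub>v w \<in> carrier_vec n" using S w by simp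
    fix j assume j: "j < n"
    have gj: "g j \<in> carrier_vec n" using gD j by simp
    have "g j \<bullet> (S *\<^sub>v w) = e * (g j \<bullet> w)"
    proof (cases "j < k")
      case True
      have "g j \<bullet> (S *\<^sub>v w) = (S *\<^sub>v g j) \<bullet> w"
        using symmetric_transfer[OF S sym w gj] by simp
      also have "\<dots> = 0" using eig[OF True] gf[OF True] fw[OF True] gj w by simp
      finally show ?thesis using fw[OF True] gf[OF True] by simp
    next
      case False
      then have jm: "j - k < m" "k + (j - k) = j" using j unfolding m_def by auto
      have *: "g j \<bullet> y = (transpose_mat W *\<^sub>v y) $ (j - k)" for y
        using W jm colW[OF jm(1)] by simp
      show ?thesis unfolding * WtSw Wtw using x jm by simp
    qed
    then show "g j \<bullet> (S *\<^sub>v w - e \<cdot>\<^sub>v w) = 0"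
      using gj w Sw by (simp add: scalar_prod_minus_distrib[of _ n])
  qed
  then have "(S *\<^sub>v w - e \<cdot>\<^sub>v w) $ i = 0" if "i < n" for i using that by simp
  then have Se: "S *\<^sub>v w = e \<cdot>\<^sub>v w"
    using w S by (intro eq_vecI) auto
  obtain a where a: "(a \<cdot>\<^sub>v w) \<bullet> (a \<cdot>\<^sub>v w) = 1" using ex_unit_scaling w w0 by blast
  have "S *\<^sub>v (a \<cdot>\<^sub>v w) = e \<cdot>\<^sub>v (a \<cdot>\<^sub>v w)"
    using S w Se by (simp add: mult_mat_vec[of _ n n] smult_smult_assoc mult.commute)
  moreover have "f j \<bullet> (a \<cdot>\<^sub>v w) = 0" if "j < k" for j
    using fw[OF that] orthonormal_familyD(1)[OF f that] w by simp
  ultimately show ?thesis using a w by (intro exI[of _ "a \<cdot>\<^sub>v w"] exI[of _ e]) auto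
qed

lemma symmetric_ex_eigenbasis:
  fixes S :: "real mat"
  assumes S: "S \<in> carrier_mat n n" and sym: "transpose_mat S = S"
  shows "\<exists>f d. orthonormal_family n n f \<and> (\<forall>j<n. S *\<^sub>v f j = d j \<cdot>\<^sub>v f j)"
proof -
  have "k \<le> n \<Longrightarrow> \<exists>f d. orthonormal_family n k f \<and> (\<forall>j<k. S *\<^sub>v f j = d j \<cdot>\<^sub>v f j)" for k
  proof (induction k)
    case 0
    then show ?case by (simp add: orthonormal_family_def)
  next
    case (Suc k)
    then obtain f d where f: "orthonormal_family n k f"
      and eig: "\<And>j. j < k \<Longrightarrow> S *\<^sub>v f j = d j \<cdot>\<^sub>v f j" by auto
    obtain v e where v: "v \<in> carrier_vec n" "v \<bullet> v = 1" "\<forall>j<k. f j \<bullet> v = 0"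
      and e: "S *\<^sub>v v = e \<cdot>\<^sub>v v"
      using symmetric_next_eigenvector[OF S sym f _ eig] Suc.prems by auto
    have "orthonormal_family n (Suc k) (f(k := v))"
      using orthonormal_family_Suc[OF f] v by blast
    moreover have "\<forall>j<Suc k. S *\<^sub>v (f(k := v)) j = (d(k := e)) j \<cdot>\<^sub>v (f(k := v)) j"
      using eig e by (auto simp: less_Suc_eq)
    ultimately show ?case by blast
  qed
  then show ?thesis by blast
qed

subsection \<open>Reduced singular value decomposition\<close>

lemma (in vec_space) mult_mat_vec_in_span_cols:
  assumes A: "A \<in> carrier_mat n nc" and x: "x \<in> carrier_vec nc"
  shows "A *\<^sub>v x \<in> span (set (cols A))"
proof -
  have cA: "set (cols A) \<subseteq> carrier_vec n" using A cols_dim by blast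
  have x': "vec nc (\<lambda>i. x $ i) = x" using x by auto
  have "lincomb_list (\<lambda>i. x $ i) (cols A) = A *\<^sub>v x"
    using A cA x' by (subst lincomb_list_as_mat_mult) (auto simp: mat_of_cols_cols)
  then show ?thesis
    using span_list_as_span[OF cA] in_span_listI[of "A *\<^sub>v x" "\<lambda>i. x $ i" "cols A"] by auto
qed

lemma (in vec_space) span_cols_mono:
  assumes A: "A \<in> carrier_mat n a" and B: "B \<in> carrier_mat n b"
    and AB: "\<And>j. j < a \<Longrightarrow> \<exists>x \<in> carrier_vec b. col A j = B *\<^sub>v x"
  shows "span (set (cols A)) \<subseteq> span (set (cols B))"
proof (rule span_is_subset)
  have "set (cols B) \<subseteq> carrier_vec n" using B cols_dim by blast
  then show "submodule class_ring (span (set (cols B))) V" by (simp add: span_is_submodule)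
  show "set (cols A) \<subseteq> span (set (cols B))"
  proof
    fix y assume "y \<in> set (cols A)"
    then obtain j where "j < a" and y: "y = col A j" using A by (auto simp: cols_def)
    then obtain x where "x \<in> carrier_vec b" "col A j = B *\<^sub>v x" using AB by blast
    then show "y \<in> span (set (cols B))" using mult_mat_vec_in_span_cols[OF B] y by simp
  qed
qed

text \<open>Columns that are mutually expressible span the same space, whose dimension is the rank.
  The numbers of columns may differ.\<close>

lemma (in vec_space) rank_eqI:
  assumes "A \<in> carrier_mat n a" and "B \<in> carrier_mat n b"
    and "\<And>j. j < a \<Longrightarrow> \<exists>x \<in> carrier_vec b. col A j = B *\<^sub>v x"
    and "\<And>j. j < b \<Longrightarrow> \<exists>x \<in> carrier_vec a. col B j = A *\<^sub>v x"
  shows "rank A = rank B"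
  using span_cols_mono[OF assms(1,2,3)] span_cols_mono[OF assms(2,1,4)]
  unfolding rank_def by simp

lemma family_mat_gram:
  assumes "orthonormal_family n k f"
  shows "transpose_mat (family_mat n k f) * family_mat n k f = 1\<^sub>m k"
  by (auto intro!: eq_matI simp: orthonormal_familyD[OF assms])

lemma rank_family_mat:
  assumes f: "orthonormal_family n k f"
  shows "mat_rank (family_mat n k f) = k"
proof -
  interpret vec_space "TYPE(real)" n .
  let ?F = "family_mat n k f"
  have F: "?F \<in> carrier_mat n k" by simp
  \<comment> \<open>Independence is a property of the set of columns, which would hide repetitions;
    distinctness makes its size equal to \<open>k\<close>.\<close>
  have dist: "distinct (cols ?F)"
    unfolding distinct_conv_nth
  proof (intro allI impI)
    fix i j assume ij: "i < length (cols ?F)" "j < length (cols ?F)" "i \<noteq> j"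
    then have "f i \<bullet> f i \<noteq> f i \<bullet> f j" using orthonormal_familyD(2)[OF f] by simp
    then show "cols ?F ! i \<noteq> cols ?F ! j" using ij orthonormal_familyD(1)[OF f] by auto
  qed
  have "lin_indpt (set (cols ?F))"
  proof (rule notI)
    assume "lin_dep (set (cols ?F))"
    then obtain x where x: "x \<in> carrier_vec k" "x \<noteq> 0\<^sub>v k" "?F *\<^sub>v x = 0\<^sub>v n"
      using lin_depE[OF F _ dist] by metis
    have "x = transpose_mat ?F *\<^sub>v (?F *\<^sub>v x)"
      using x(1) family_mat_gram[OF f] by (subst assoc_mult_mat_vec[symmetric, of _ k n _ k]) auto
    then show False using x by (auto intro!: eq_vecI)
  qed
  then show ?thesis using lin_indpt_full_rank[OF F dist] by simp
qed

text \<open>An eigenbasis of \<open>A^T A\<close> is used: eigenvectors with positive eigenvalue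
  become the \<open>v k\<close>, the square roots of these eigenvalues the
  \<open>\<sigma> k\<close>, and \<open>u k\<close> is the normalised image of \<open>v k\<close>.
  Here \<open>r\<close> counts the positive eigenvalues; that it is the rank is shown
  separately.\<close>

lemma reduced_svd_ex:
  fixes A :: "real mat"
  assumes A: "A \<in> carrier_mat m n"
  shows "\<exists>r v u \<sigma>. orthonormal_family n r v \<and> orthonormal_family m r u \<and>
    (\<forall>k<r. \<sigma> k > 0 \<and> A *\<^sub>v v k = \<sigma> k \<cdot>\<^sub>v u k \<and> transpose_mat A *\<^sub>v u k = \<sigma> k \<cdot>\<^sub>v v k) \<and>
    (\<forall>w \<in> carrier_vec n. (\<forall>k<r. v k \<bullet> w = 0) \<longrightarrow> A *\<^sub>v w = 0\<^sub>v m)"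
proof -
  have At: "transpose_mat A \<in> carrier_mat n m" using A by simp
  define S where "S = transpose_mat A * A"
  have S: "S \<in> carrier_mat n n" unfolding S_def using A by simp
  have sym: "transpose_mat S = S" unfolding S_def using A by (simp add: transpose_mult[OF At A])
  have Sx: "S *\<^sub>v x = transpose_mat A *\<^sub>v (A *\<^sub>v x)" if "x \<in> carrier_vec n" for x
    unfolding S_def using At A that by simp
  obtain f d where f: "orthonormal_family n n f" and eig: "\<And>j. j < n \<Longrightarrow> S *\<^sub>v f j = d j \<cdot>\<^sub>v f j"
    using symmetric_ex_eigenbasis[OF S sym] by auto
  note fD = orthonormal_familyD[OF f]
  have AA: "(A *\<^sub>v f i) \<bullet> (A *\<^sub>v f j) = (if i = j then d i else 0)" if "i < n" "j < n" for i j
  proof -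
    have "(A *\<^sub>v f i) \<bullet> (A *\<^sub>v f j) = (S *\<^sub>v f i) \<bullet> f j"
      using transpose_vec_mult_scalar[OF A, of "f j" "A *\<^sub>v f i"] A fD that Sx by simp
    also have "\<dots> = d i * (f i \<bullet> f j)" using eig that fD(1)[OF that(1)] fD(1)[OF that(2)] by simp
    finally show ?thesis using fD that by simp
  qed
  have d0: "d j \<ge> 0" if "j < n" for j
    using AA[OF that that] real_scalar_prod_self(1)[of "A *\<^sub>v f j"] by simp
  define K where "K = {j. j < n \<and> d j > 0}"
  define r where "r = card K"
  have "finite K" unfolding K_def by simp
  \<comment> \<open>The enumeration is arbitrary: the singular values are not sorted.\<close>
  then obtain e where e: "bij_betw e {0..<r} K"
    using ex_bij_betw_nat_finite unfolding r_def by blast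
  have eK: "e k < n" "d (e k) > 0" if "k < r" for k
    using bij_betwE[OF e] that unfolding K_def by auto
  have einj: "e i = e j \<longleftrightarrow> i = j" if "i < r" "j < r" for i j
    using bij_betw_imp_inj_on[OF e] that unfolding inj_on_def by auto
  define v where "v k = f (e k)" for k
  define \<sigma> where "\<sigma> k = sqrt (d (e k))" for k
  define u where "u k = inverse (\<sigma> k) \<cdot>\<^sub>v (A *\<^sub>v v k)" for k
  have pos: "\<sigma> k > 0" if "k < r" for k using eK[OF that] unfolding \<sigma>_def by simp
  have sq: "d (e k) = \<sigma> k * \<sigma> k" if "k < r" for k using eK[OF that] unfolding \<sigma>_def by simp
  have vc: "v k \<in> carrier_vec n" if "k < r" for k unfolding v_def using fD eK that by simp
  have Avc: "A *\<^sub>v v k \<in> carrier_vec m" if "k < r" for k using A vc[OF that] by simp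
  have v: "orthonormal_family n r v"
    unfolding orthonormal_family_def v_def using fD eK einj by simp
  have "u i \<bullet> u j = (if i = j then 1 else 0)" if "i < r" "j < r" for i j
  proof -
    have "u i \<bullet> u j = inverse (\<sigma> i) * (inverse (\<sigma> j) * ((A *\<^sub>v v i) \<bullet> (A *\<^sub>v v j)))"
      unfolding u_def using Avc that A by simp
    also have "(A *\<^sub>v v i) \<bullet> (A *\<^sub>v v j) = (if i = j then \<sigma> i * \<sigma> i else 0)"
      unfolding v_def using AA eK that einj sq by simp
    finally show ?thesis using pos[OF that(1)] by (auto simp: inverse_eq_divide)
  qed
  moreover have uc: "u k \<in> carrier_vec m" if "k < r" for k unfolding u_def using Avc that by simp
  ultimately have u: "orthonormal_family m r u" unfolding orthonormal_family_def by blast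
  have Av: "A *\<^sub>v v k = \<sigma> k \<cdot>\<^sub>v u k" if "k < r" for k
    unfolding u_def using pos[OF that] by (simp add: smult_smult_assoc)
  have "transpose_mat A *\<^sub>v u k = \<sigma> k \<cdot>\<^sub>v v k" if k: "k < r" for k
  proof -
    have "transpose_mat A *\<^sub>v u k = inverse (\<sigma> k) \<cdot>\<^sub>v (S *\<^sub>v v k)"
      unfolding u_def Sx[OF vc[OF k]] by (rule mult_mat_vec[OF At Avc[OF k]])
    also have "S *\<^sub>v v k = (\<sigma> k * \<sigma> k) \<cdot>\<^sub>v v k"
      unfolding v_def using eig eK k sq by simp
    finally show ?thesis using pos[OF k] by (simp add: smult_smult_assoc inverse_eq_divide)
  qed
  moreover have "A *\<^sub>v w = 0\<^sub>v m" if w: "w \<in> carrier_vec n" and orth: "\<forall>k<r. v k \<bullet> w = 0" for w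
  proof -
    \<comment> \<open>Each eigenvector either has eigenvalue zero or is one of the
      \<open>v k\<close>, to which \<open>w\<close> is orthogonal. From \<open>S w = 0\<close> it
      follows that the squared length of \<open>A w\<close> is zero.\<close>
    have "S *\<^sub>v w = 0\<^sub>v n"
    proof (rule orthonormal_family_complete[OF f])
      show "S *\<^sub>v w \<in> carrier_vec n" using S w by simp
      fix j assume j: "j < n"
      have "f j \<bullet> (S *\<^sub>v w) = d j * (f j \<bullet> w)"
        using symmetric_transfer[OF S sym w fD(1)[OF j]] eig[OF j] fD(1)[OF j] w by simp
      moreover have "d j = 0 \<or> f j \<bullet> w = 0"
      proof (cases "d j > 0")
        case True
        then have "j \<in> e ` {0..<r}" using e j unfolding bij_betw_def K_def by simp
        then show ?thesis using orth unfolding v_def by auto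
      qed (use d0[OF j] in simp)
      ultimately show "f j \<bullet> (S *\<^sub>v w) = 0" by auto
    qed
    then have "(A *\<^sub>v w) \<bullet> (A *\<^sub>v w) = 0"
      using transpose_vec_mult_scalar[OF A w, of "A *\<^sub>v w"] A w Sx by simp
    then show ?thesis using real_scalar_prod_self(2)[of "A *\<^sub>v w" m] A w by simp
  qed
  ultimately show ?thesis
    using u v pos Av by (intro exI[of _ r] exI[of _ v] exI[of _ u] exI[of _ \<sigma>]) blast
qed

text \<open>The column space of \<open>A\<close> is spanned by the \<open>r\<close> orthonormal
  vectors \<open>u k\<close>.\<close>

lemma rank_reduced_svd:
  fixes A :: "real mat"
  assumes A: "A \<in> carrier_mat m n"
    and v: "orthonormal_family n r v" and u: "orthonormal_family m r u"
    and pos: "\<And>k. k < r \<Longrightarrow> \<sigma> k > 0"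
    and Av: "\<And>k. k < r \<Longrightarrow> A *\<^sub>v v k = \<sigma> k \<cdot>\<^sub>v u k"
    and ker: "\<And>w. w \<in> carrier_vec n \<Longrightarrow> (\<And>k. k < r \<Longrightarrow> v k \<bullet> w = 0) \<Longrightarrow> A *\<^sub>v w = 0\<^sub>v m"
  shows "mat_rank A = r"
proof -
  interpret vec_space "TYPE(real)" m .
  note vD = orthonormal_familyD[OF v] and uD = orthonormal_familyD[OF u]
  let ?F = "family_mat n r v" and ?G = "family_mat m r u"
  have F: "?F \<in> carrier_mat n r" and G: "?G \<in> carrier_mat m r" by simp_all
  have AF: "A * ?F = ?G * mat_diag r \<sigma>"
  proof (rule eq_matI)
    fix i j assume "i < dim_row (?G * mat_diag r \<sigma>)" "j < dim_col (?G * mat_diag r \<sigma>)"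
    then have ij: "i < m" "j < r" by (auto simp: mat_diag_def)
    have "(A * ?F) $$ (i, j) = (A *\<^sub>v v j) $ i" using A ij vD by simp
    also have "\<dots> = \<sigma> j * u j $ i" using Av[OF ij(2)] ij carrier_vecD[OF uD(1)[OF ij(2)]] by simp
    finally show "(A * ?F) $$ (i, j) = (?G * mat_diag r \<sigma>) $$ (i, j)"
      using ij unfolding mat_diag_mult_right[OF G] by (simp add: family_mat_def)
  qed (use A in \<open>auto simp: mat_diag_def\<close>)
  \<comment> \<open>This is the factorisation \<open>A = G D F^T\<close>. Subtracting from
    \<open>w\<close> its projection \<open>F F^T w\<close> leaves a vector orthogonal to every
    \<open>v k\<close>, which \<open>A\<close> annihilates.\<close>
  have range: "A *\<^sub>v w = ?G *\<^sub>v (mat_diag r \<sigma> *\<^sub>v (transpose_mat ?F *\<^sub>v w))"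
    if w: "w \<in> carrier_vec n" for w
  proof -
    define x where "x = transpose_mat ?F *\<^sub>v w"
    have x: "x \<in> carrier_vec r"
      unfolding x_def using w by (intro mult_mat_vec_carrier[of _ r n]) auto
    have Fx: "?F *\<^sub>v x \<in> carrier_vec n" using x by (intro mult_mat_vec_carrier[of _ n r]) auto
    have "A *\<^sub>v (w - ?F *\<^sub>v x) = 0\<^sub>v m"
    proof (rule ker)
      fix k assume k: "k < r"
      have *: "v k \<bullet> y = (transpose_mat ?F *\<^sub>v y) $ k" for y
        using k vD by simp
      have "transpose_mat ?F *\<^sub>v (?F *\<^sub>v x) = x"
        using family_mat_gram[OF v] x by (subst assoc_mult_mat_vec[symmetric, of _ r n _ r]) auto
      then have "v k \<bullet> (?F *\<^sub>v x) = v k \<bullet> w" unfolding * x_def by simp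
      then show "v k \<bullet> (w - ?F *\<^sub>v x) = 0"
        using vD(1)[OF k] w Fx by (simp add: scalar_prod_minus_distrib[of _ n])
    qed (use w Fx in auto)
    then have "A *\<^sub>v w - A *\<^sub>v (?F *\<^sub>v x) = 0\<^sub>v m"
      using A w Fx by (simp add: mult_minus_distrib_mat_vec)
    then have "(A *\<^sub>v w - A *\<^sub>v (?F *\<^sub>v x)) $ i = 0" if "i < m" for i using that by simp
    then have "A *\<^sub>v w = A *\<^sub>v (?F *\<^sub>v x)" using A w Fx by (intro eq_vecI) auto
    also have "\<dots> = (A * ?F) *\<^sub>v x" using A x by (simp add: assoc_mult_mat_vec[of _ m n _ r])
    finally show ?thesis unfolding AF x_def[symmetric] using x
      by (simp add: assoc_mult_mat_vec[of _ m r _ r])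
  qed
  have "rank A = rank ?G"
  proof (rule rank_eqI[OF A G])
    fix j assume j: "j < n"
    have "col A j = A *\<^sub>v unit_vec n j" using A j by (intro eq_vecI) auto
    moreover define x where "x = mat_diag r \<sigma> *\<^sub>v (transpose_mat ?F *\<^sub>v unit_vec n j)"
    ultimately have "col A j = ?G *\<^sub>v x" using range[of "unit_vec n j"] by simp
    moreover have "x \<in> carrier_vec r" unfolding x_def
      by (rule mult_mat_vec_carrier[of _ r r], simp, rule mult_mat_vec_carrier[of _ r n]) auto
    ultimately show "\<exists>x \<in> carrier_vec r. col A j = ?G *\<^sub>v x" by blast
  next
    fix k assume k: "k < r"
    have "A *\<^sub>v (inverse (\<sigma> k) \<cdot>\<^sub>v v k) = inverse (\<sigma> k) \<cdot>\<^sub>v (A *\<^sub>v v k)"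
      by (rule mult_mat_vec[OF A vD(1)[OF k]])
    also have "\<dots> = u k" using Av[OF k] pos[OF k] by (simp add: smult_smult_assoc)
    finally have "col ?G k = A *\<^sub>v (inverse (\<sigma> k) \<cdot>\<^sub>v v k)" using uD(1)[OF k] k by simp
    moreover have "inverse (\<sigma> k) \<cdot>\<^sub>v v k \<in> carrier_vec n" using vD(1)[OF k] by simp
    ultimately show "\<exists>x \<in> carrier_vec n. col ?G k = A *\<^sub>v x" by blast
  qed
  then show ?thesis using rank_family_mat[OF u] A by simp
qed

lemma reduced_svd:
  fixes A :: "real mat"
  assumes A: "A \<in> carrier_mat m n" and r: "r = mat_rank A"
  shows "\<exists>v u \<sigma>. orthonormal_family n r v \<and> orthonormal_family m r u \<and>
    (\<forall>k<r. \<sigma> k > 0 \<and> A *\<^sub>v v k = \<sigma> k \<cdot>\<^sub>v u k \<and> transpose_mat A *\<^sub>v u k = \<sigma> k \<cdot>\<^sub>v v k) \<and>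
    (\<forall>w \<in> carrier_vec n. (\<forall>k<r. v k \<bullet> w = 0) \<longrightarrow> A *\<^sub>v w = 0\<^sub>v m)"
proof -
  obtain s v u \<sigma> where s: "orthonormal_family n s v" "orthonormal_family m s u"
    "\<forall>k<s. \<sigma> k > 0 \<and> A *\<^sub>v v k = \<sigma> k \<cdot>\<^sub>v u k \<and> transpose_mat A *\<^sub>v u k = \<sigma> k \<cdot>\<^sub>v v k"
    "\<forall>w \<in> carrier_vec n. (\<forall>k<s. v k \<bullet> w = 0) \<longrightarrow> A *\<^sub>v w = 0\<^sub>v m"
    using reduced_svd_ex[OF A] by blast
  have "mat_rank A = s" by (rule rank_reduced_svd[OF A s(1,2)]) (use s(3,4) in blast)+
  then show ?thesis using s r by blast
qed

subsection \<open>Block form and sign changes\<close>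

text \<open>As \<open>S\<close> is diagonal, only the positions \<open>(a + q, q)\<close> with
  \<open>q < b\<close> can be nonzero. This entrywise form is what congruences and sign changes are
  compared with.\<close>

lemma nine_block_mat_eq:
  assumes "S \<in> carrier_mat b b" and "diagonal_mat S"
  shows "nine_block_mat (0\<^sub>m a b) (0\<^sub>m a d) (0\<^sub>m a e) S (0\<^sub>m b d) (0\<^sub>m b e) (0\<^sub>m h b) (0\<^sub>m h d) (0\<^sub>m h e) =
    mat (a + b + h) (b + d + e) (\<lambda>(p, q). if q < b \<and> p = a + q then S $$ (q, q) else 0)"
proof (rule eq_matI)
  fix p q
  assume "p < dim_row (mat (a + b + h) (b + d + e) (\<lambda>(p, q). if q < b \<and> p = a + q then S $$ (q, q) else 0))"
    and "q < dim_col (mat (a + b + h) (b + d + e) (\<lambda>(p, q). if q < b \<and> p = a + q then S $$ (q, q) else 0))"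
  then have "p < a + b + h" "q < b + d + e" by simp_all
  moreover have "S $$ (p - a, q) = (if p = a + q then S $$ (q, q) else 0)"
    if "q < b" "\<not> p < a" "p < a + b"
    using that assms unfolding diagonal_mat_def by auto
  ultimately show "nine_block_mat (0\<^sub>m a b) (0\<^sub>m a d) (0\<^sub>m a e) S (0\<^sub>m b d) (0\<^sub>m b e) (0\<^sub>m h b) (0\<^sub>m h d) (0\<^sub>m h e) $$ (p, q) =
      mat (a + b + h) (b + d + e) (\<lambda>(p, q). if q < b \<and> p = a + q then S $$ (q, q) else 0) $$ (p, q)"
    using assms(1) unfolding nine_block_mat_def append_rows_def by auto
qed (use assms in \<open>auto simp: nine_block_mat_def append_rows_def\<close>)

lemma orthonormal_family_join:
  assumes f: "orthonormal_family n a f" and g: "orthonormal_family n b g"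
    and fg: "\<And>i j. i < a \<Longrightarrow> j < b \<Longrightarrow> f i \<bullet> g j = 0"
  shows "orthonormal_family n (a + b) (\<lambda>q. if q < a then f q else g (q - a))"
proof -
  have "g j \<bullet> f i = 0" if "i < a" "j < b" for i j
    using fg[OF that] comm_scalar_prod orthonormal_familyD(1)[OF f] orthonormal_familyD(1)[OF g] that
    by metis
  then show ?thesis
    using fg orthonormal_familyD[OF f] orthonormal_familyD[OF g]
    unfolding orthonormal_family_def by auto
qed

text \<open>Reading off \<open>A\<close> in the two families turns the block form into a statement
  about single scalar products.\<close>

lemma family_mat_congruence:
  fixes A :: "'a :: comm_ring_1 mat"
  assumes A: "A \<in> carrier_mat m n"
    and f: "\<And>p. p < k \<Longrightarrow> f p \<in> carrier_vec m" and g: "\<And>q. q < l \<Longrightarrow> g q \<in> carrier_vec n"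
  shows "transpose_mat (family_mat m k f) * A * family_mat n l g =
    mat k l (\<lambda>(p, q). f p \<bullet> (A *\<^sub>v g q))"
proof -
  have "transpose_mat (family_mat m k f) * A * family_mat n l g =
      transpose_mat (family_mat m k f) * (A * family_mat n l g)"
    using A by (simp add: assoc_mult_mat[of _ k m _ n _ l])
  also have "\<dots> = mat k l (\<lambda>(p, q). f p \<bullet> (A *\<^sub>v g q))"
  proof (rule eq_matI)
    fix p q assume "p < dim_row (mat k l (\<lambda>(p, q). f p \<bullet> (A *\<^sub>v g q)))"
      "q < dim_col (mat k l (\<lambda>(p, q). f p \<bullet> (A *\<^sub>v g q)))"
    then have pq: "p < k" "q < l" by simp_all
    have "col (A * family_mat n l g) q = A *\<^sub>v g q"
      using A pq g by (intro eq_vecI) auto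
    then show "(transpose_mat (family_mat m k f) * (A * family_mat n l g)) $$ (p, q) =
        mat k l (\<lambda>(p, q). f p \<bullet> (A *\<^sub>v g q)) $$ (p, q)"
      using pq f by simp
  qed auto
  finally show ?thesis .
qed

text \<open>A diagonal matrix is its own transpose, so the new factors move to the outside and scale
  rows and columns. The case \<open>A = 1\<close> gives orthonormality, the general case the block
  form.\<close>

lemma diag_congruence:
  fixes A :: "'a :: comm_ring_1 mat"
  assumes U: "U \<in> carrier_mat m m" and A: "A \<in> carrier_mat m n" and V: "V \<in> carrier_mat n n"
    and eq: "transpose_mat U * A * V = mat m n F"
  shows "transpose_mat (U * mat_diag m x) * A * (V * mat_diag n y) =
    mat m n (\<lambda>(p, q). x p * F (p, q) * y q)"
proof -
  have D: "transpose_mat (mat_diag m x) = mat_diag m x"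
    by (intro eq_matI) (auto simp: mat_diag_def)
  have "transpose_mat (U * mat_diag m x) * A * (V * mat_diag n y) =
      mat_diag m x * (transpose_mat U * A * V) * mat_diag n y"
    using U A V by (simp add: transpose_mult[of _ m m _ m] D assoc_mult_mat[of _ m m _ m _ n]
      assoc_mult_mat[of _ m m _ n _ n] assoc_mult_mat[of _ m n _ n _ n] assoc_mult_mat[of _ m m _ m _ m])
  also have "\<dots> = mat m n (\<lambda>(p, q). x p * F (p, q) * y q)"
    unfolding eq by (subst mat_diag_mult_left[of _ m n], simp, subst mat_diag_mult_right[of _ m n], simp)
      (auto intro!: eq_matI)
  finally show ?thesis .
qed

section \<open>Determinants and column signs\<close>

lemma det_mat_diag: "det (mat_diag n f) = (\<Prod>q<n. f q)"
proof -
  have "det (mat_diag n f) = prod_list (diag_mat (mat_diag n f))"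
    by (rule det_upper_triangular[of _ n]) (auto simp: mat_diag_def)
  also have "diag_mat (mat_diag n f) = map f [0..<n]"
    by (simp add: diag_mat_def mat_diag_def)
  finally show ?thesis
    using prod.distinct_set_conv_list[of "[0..<n]" f] by (simp add: atLeast0LessThan)
qed

lemma orthonormal_mat_det:
  assumes "orthonormal_mat n U"
  shows "det U * det U = 1"
proof -
  have U: "U \<in> carrier_mat n n" and "transpose_mat U * U = 1\<^sub>m n"
    using assms unfolding orthonormal_mat_def by auto
  then show ?thesis using det_mult[of "transpose_mat U" n U] by (simp add: det_transpose[OF U])
qed

lemma orthonormal_mat_scale_cols:
  assumes U: "orthonormal_mat n U" and e: "\<And>q. q < n \<Longrightarrow> e q * e q = 1"
  shows "orthonormal_mat n (U * mat_diag n e)"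
proof -
  have Uc: "U \<in> carrier_mat n n" and UU: "transpose_mat U * U = 1\<^sub>m n"
    using U unfolding orthonormal_mat_def by auto
  have "transpose_mat U * 1\<^sub>m n * U = mat n n (\<lambda>(p, q). if p = q then 1 else 0)"
    using Uc UU by auto
  from diag_congruence[OF Uc one_carrier_mat Uc this, of e e]
  have "transpose_mat (U * mat_diag n e) * (U * mat_diag n e) = 1\<^sub>m n"
    using Uc e by (auto simp: transpose_mult[of _ n n _ n] intro!: eq_matI)
  then show ?thesis using Uc unfolding orthonormal_mat_def by simp
qed

text \<open>The blocks of sizes \<open>a\<close>, \<open>b\<close> and \<open>h\<close> are the
  column blocks of some \<open>U i\<close>. Each nonempty block carries its sign on its first
  column; the sign of an empty block occurs at no column below \<open>a + b + h\<close>.\<close>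

definition block_signs :: "nat \<Rightarrow> nat \<Rightarrow> real \<Rightarrow> real \<Rightarrow> real \<Rightarrow> nat \<Rightarrow> real" where
  "block_signs a b x y z q =
     (if q < a then (if q = 0 then x else 1)
      else if q < a + b then (if q = a then y else 1)
      else if q = a + b then z else 1)"

lemma prod_block_signs:
  assumes "a = 0 \<Longrightarrow> x = 1" and "b = 0 \<Longrightarrow> y = 1" and "h = 0 \<Longrightarrow> z = 1"
  shows "(\<Prod>q<a + b + h. block_signs a b x y z q) = x * y * z"
proof -
  have first: "(\<Prod>q<k. if q = 0 then w else 1) = w" if "k = 0 \<Longrightarrow> w = 1" for k :: nat and w :: real
    using that by (cases "k = 0") auto
  have split: "(\<Prod>q<k + l. F q) = (\<Prod>q<k. F q) * (\<Prod>q<l. F (k + q))" for k l and F :: "nat \<Rightarrow> real"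
    by (induction l) (simp_all add: mult.assoc)
  have "(\<Prod>q<a. block_signs a b x y z q) = (\<Prod>q<a. if q = 0 then x else 1)"
    by (rule prod.cong) (auto simp: block_signs_def)
  moreover have "(\<Prod>q<b. block_signs a b x y z (a + q)) = (\<Prod>q<b. if q = 0 then y else 1)"
    by (rule prod.cong) (auto simp: block_signs_def)
  moreover have "(\<Prod>q<h. block_signs a b x y z (a + b + q)) = (\<Prod>q<h. if q = 0 then z else 1)"
    by (rule prod.cong) (auto simp: block_signs_def)
  ultimately show ?thesis using first assms by (simp add: split)
qed

subsection \<open>Singular value decomposition of a complex\<close>

text \<open>Since \<open>h i\<close> is a truncated difference, the second conclusion is what makes
  the block sizes add up to \<open>c i\<close>.\<close>

lemma complex_svd_ex:
  fixes n :: nat and c r h :: "nat \<Rightarrow> nat" and A :: "nat \<Rightarrow> real mat"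
  assumes A: "\<And>i. i \<in> {1..n} \<Longrightarrow> A i \<in> carrier_mat (c (i - 1)) (c i)"
    and cx: "\<And>i. i \<in> {1..n - 1} \<Longrightarrow> A i * A (i + 1) = 0\<^sub>m (c (i - 1)) (c (i + 1))"
    and r: "\<And>i. i \<in> {1..n} \<Longrightarrow> r i = mat_rank (A i)"
    and r0: "r 0 = 0" and rn: "r (n + 1) = 0"
    and h: "\<And>i. i \<in> {0..n} \<Longrightarrow> h i = c i - (r i + r (i + 1))"
  shows "\<exists>U \<Sigma>. complex_svd n c r h A U \<Sigma>" and "i \<in> {0..n} \<Longrightarrow> r i + r (i + 1) \<le> c i"
proof -
  have "\<forall>i\<in>{1..n}. \<exists>v u \<sigma>. orthonormal_family (c i) (r i) v \<and> orthonormal_family (c (i - 1)) (r i) u \<and>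
    (\<forall>k<r i. \<sigma> k > 0 \<and> A i *\<^sub>v v k = \<sigma> k \<cdot>\<^sub>v u k \<and> transpose_mat (A i) *\<^sub>v u k = \<sigma> k \<cdot>\<^sub>v v k) \<and>
    (\<forall>w \<in> carrier_vec (c i). (\<forall>k<r i. v k \<bullet> w = 0) \<longrightarrow> A i *\<^sub>v w = 0\<^sub>v (c (i - 1)))"
    using reduced_svd[OF A r] by blast
  then obtain v u \<sigma> where svd: "\<forall>i\<in>{1..n}. orthonormal_family (c i) (r i) (v i) \<and>
    orthonormal_family (c (i - 1)) (r i) (u i) \<and>
    (\<forall>k<r i. \<sigma> i k > 0 \<and> A i *\<^sub>v v i k = \<sigma> i k \<cdot>\<^sub>v u i k \<and> transpose_mat (A i) *\<^sub>v u i k = \<sigma> i k \<cdot>\<^sub>v v i k) \<and>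
    (\<forall>w \<in> carrier_vec (c i). (\<forall>k<r i. v i k \<bullet> w = 0) \<longrightarrow> A i *\<^sub>v w = 0\<^sub>v (c (i - 1)))"
    by metis
  \<comment> \<open>At the ends \<open>v 0\<close> and \<open>u (n + 1)\<close> come from no matrix,
    but they count as empty families because \<open>r 0\<close> and \<open>r (n + 1)\<close> are
    zero.\<close>
  have v: "orthonormal_family (c i) (r i) (v i)" if "i \<le> n" for i
    using svd r0 that by (cases "i = 0") (auto simp: orthonormal_family_def)
  have u: "orthonormal_family (c i) (r (i + 1)) (u (i + 1))" if "i \<le> n" for i
    using svd rn that by (cases "i = n") (force simp: orthonormal_family_def)+
  have pos: "\<sigma> i k > 0" and Av: "A i *\<^sub>v v i k = \<sigma> i k \<cdot>\<^sub>v u i k"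
    and Au: "transpose_mat (A i) *\<^sub>v u i k = \<sigma> i k \<cdot>\<^sub>v v i k"
    if "i \<in> {1..n}" "k < r i" for i k
    using svd that by blast+
  have ker: "A i *\<^sub>v w = 0\<^sub>v (c (i - 1))"
    if "i \<in> {1..n}" "w \<in> carrier_vec (c i)" "\<And>k. k < r i \<Longrightarrow> v i k \<bullet> w = 0" for i w
    using svd that by blast
  have vu: "v i k \<bullet> u (i + 1) l = 0" if i: "i \<le> n" and k: "k < r i" and l: "l < r (i + 1)" for i k l
  proof -
    \<comment> \<open>Existing indices \<open>k\<close> and \<open>l\<close> exclude the two ends,
      so both \<open>A i\<close> and \<open>A (i + 1)\<close> belong to the complex.\<close>
    have "i \<noteq> 0" "i \<noteq> n" using k l r0 rn by (auto intro: gr0I)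
    with i have i1: "i \<in> {1..n}" "i + 1 \<in> {1..n}" "i \<in> {1..n - 1}" by auto
    have Ai: "A i \<in> carrier_mat (c (i - 1)) (c i)" and Ai1: "A (i + 1) \<in> carrier_mat (c i) (c (i + 1))"
      using A[OF i1(1)] A[OF i1(2)] by simp_all
    have vk: "v i k \<in> carrier_vec (c i)" and uk: "u i k \<in> carrier_vec (c (i - 1))"
      and ul: "u (i + 1) l \<in> carrier_vec (c i)" and vl: "v (i + 1) l \<in> carrier_vec (c (i + 1))"
      using orthonormal_familyD(1)[OF v] orthonormal_familyD(1)[OF u] i i1 k l
        orthonormal_familyD(1)[OF u[of "i - 1"]] by auto
    \<comment> \<open>Both vectors are written as images, one under \<open>A i\<close> transposed
      and one under \<open>A (i + 1)\<close>. Moving the transpose across produces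
      \<open>A i * A (i + 1) = 0\<close>, and the positive factors cancel.\<close>
    have "\<sigma> (i + 1) l * (\<sigma> i k * (v i k \<bullet> u (i + 1) l)) =
        (transpose_mat (A i) *\<^sub>v u i k) \<bullet> (A (i + 1) *\<^sub>v v (i + 1) l)"
      using Au[OF i1(1) k] Av[OF i1(2) l] vk ul by simp
    also have "\<dots> = u i k \<bullet> (A i *\<^sub>v (A (i + 1) *\<^sub>v v (i + 1) l))"
      using transpose_vec_mult_scalar[OF Ai _ uk] Ai1 vl by simp
    also have "A i *\<^sub>v (A (i + 1) *\<^sub>v v (i + 1) l) = 0\<^sub>v (c (i - 1))"
      unfolding assoc_mult_mat_vec[OF Ai Ai1 vl, symmetric] cx[OF i1(3)]
      using vl by (intro eq_vecI) auto
    finally show ?thesis using pos[OF i1(1) k] pos[OF i1(2) l] uk by simp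
  qed
  have join: "orthonormal_family (c i) (r i + r (i + 1)) (\<lambda>q. if q < r i then v i q else u (i + 1) (q - r i))"
    if "i \<le> n" for i
    using orthonormal_family_join[OF v u] vu that by blast
  show le: "r i + r (i + 1) \<le> c i" if "i \<in> {0..n}" for i
    using orthonormal_family_le[OF join] that by simp
  have "\<forall>i\<in>{0..n}. \<exists>g. orthonormal_family (c i) (c i) g \<and>
      (\<forall>q<r i + r (i + 1). g q = (if q < r i then v i q else u (i + 1) (q - r i)))"
    using orthonormal_family_extend[OF le join] by simp
  then obtain g where g0: "\<forall>i\<in>{0..n}. orthonormal_family (c i) (c i) (g i) \<and>
      (\<forall>q<r i + r (i + 1). g i q = (if q < r i then v i q else u (i + 1) (q - r i)))"
    by metis
  have g: "orthonormal_family (c i) (c i) (g i)" if "i \<le> n" for i using g0 that by auto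
  have gv: "g i q = v i q" if "i \<le> n" "q < r i" for i q using g0 that by auto
  have gu: "g i (r i + q) = u (i + 1) q" if "i \<le> n" "q < r (i + 1)" for i q using g0 that by auto
  define U where "U i = family_mat (c i) (c i) (g i)" for i
  define \<Sigma> where "\<Sigma> i = mat_diag (r i) (\<sigma> i)" for i
  have \<Sigma>: "\<Sigma> i \<in> carrier_mat (r i) (r i)" "diagonal_mat (\<Sigma> i)" for i
    unfolding \<Sigma>_def by (auto simp: mat_diag_def diagonal_mat_def)
  have \<Sigma>i: "\<Sigma> i $$ (k, k) = \<sigma> i k" if "k < r i" for i k
    unfolding \<Sigma>_def using that by (simp add: mat_diag_def)
  have "complex_svd n c r h A U \<Sigma>"
    unfolding complex_svd_def
  proof (intro conjI ballI allI impI)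
    fix i assume "i \<in> {0..n}"
    then show "orthonormal_mat (c i) (U i)" unfolding U_def by (simp add: orthonormal_mat_family_mat g)
  next
    fix i assume i: "i \<in> {1..n}"
    then obtain j where j: "i = Suc j" "j \<le> n" "Suc j \<le> n" by (cases i) auto
    have cj: "r j + r i + h j = c j" using h[of j] le[of j] j by simp
    have ci: "r i + r (i + 1) + h i = c i" using h[of i] le[of i] i by simp
    have gjc: "g j p \<in> carrier_vec (c j)" if "p < c j" for p using orthonormal_familyD[OF g] j that by simp
    have gic: "g i q \<in> carrier_vec (c i)" if "q < c i" for q using orthonormal_familyD[OF g] i that by simp
    have Ai: "A i \<in> carrier_mat (c j) (c i)" using A[OF i] j by simp
    have "g j p \<bullet> (A i *\<^sub>v g i q) = (if q < r i \<and> p = r j + q then \<Sigma> i $$ (q, q) else 0)"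
      if p: "p < c j" and q: "q < c i" for p q
    proof (cases "q < r i")
      case True
      have rq: "r j + q < c j" using True cj by simp
      \<comment> \<open>The vector \<open>u i q\<close> occupies column \<open>r j + q\<close> of
        \<open>U j\<close>, which accounts for the row offset of \<open>\<Sigma> i\<close>.\<close>
      have "A i *\<^sub>v g i q = \<sigma> i q \<cdot>\<^sub>v g j (r j + q)"
        using Av[OF i True] gv[of i q] gu[of j q] i j True by simp
      then show ?thesis
        using gjc[OF p] gjc[OF rq] orthonormal_familyD(2)[OF g[OF j(2)] p rq] True \<Sigma>i by simp
    next
      case False
      \<comment> \<open>Every column after the first \<open>r i\<close> is orthogonal to all
        \<open>v i k\<close> and hence lies in the kernel.\<close>
      have "A i *\<^sub>v g i q = 0\<^sub>v (c j)"
      proof -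
        have "v i k \<bullet> g i q = 0" if "k < r i" for k
          using orthonormal_familyD(2)[OF g, of i k q] gv[of i k] that False q i ci by simp
        then show ?thesis using ker[OF i gic[OF q]] j by simp
      qed
      then show ?thesis using False gjc[OF p] by simp
    qed
    then show "transpose_mat (U (i - 1)) * A i * U i =
        nine_block_mat
          (0\<^sub>m (r (i - 1)) (r i)) (0\<^sub>m (r (i - 1)) (r (i + 1))) (0\<^sub>m (r (i - 1)) (h i))
          (\<Sigma> i)                 (0\<^sub>m (r i) (r (i + 1)))       (0\<^sub>m (r i) (h i))
          (0\<^sub>m (h (i - 1)) (r i)) (0\<^sub>m (h (i - 1)) (r (i + 1))) (0\<^sub>m (h (i - 1)) (h i))"
      using family_mat_congruence[OF Ai gjc gic] j cj ci
      unfolding U_def nine_block_mat_eq[OF \<Sigma>] by (auto intro!: cong_mat)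
  qed (use \<Sigma> \<Sigma>i pos in auto)
  then show "\<exists>U \<Sigma>. complex_svd n c r h A U \<Sigma>" by blast
qed

text \<open>The sign \<open>s i\<close> is shared by the columns of \<open>U (i - 1)\<close> and \<open>U i\<close> that are paired by the
  first diagonal entry of \<open>\<Sigma> i\<close>, so the signs cancel in the product.\<close>

lemma complex_svd_change_signs:
  fixes c r h :: "nat \<Rightarrow> nat" and s t :: "nat \<Rightarrow> real"
  assumes svd: "complex_svd n c r h A U \<Sigma>"
    and A: "\<And>i. i \<in> {1..n} \<Longrightarrow> A i \<in> carrier_mat (c (i - 1)) (c i)"
    and c: "\<And>i. i \<in> {0..n} \<Longrightarrow> c i = r i + r (i + 1) + h i"
    and s: "\<And>i. s i * s i = 1" and t: "\<And>i. t i * t i = 1"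
  shows "complex_svd n c r h A
    (\<lambda>i. U i * mat_diag (c i) (block_signs (r i) (r (i + 1)) (s i) (s (i + 1)) (t i))) \<Sigma>"
proof -
  let ?e = "\<lambda>i. block_signs (r i) (r (i + 1)) (s i) (s (i + 1)) (t i)"
  have U: "orthonormal_mat (c i) (U i)" if "i \<in> {0..n}" for i
    using svd that unfolding complex_svd_def by blast
  have e: "?e i q * ?e i q = 1" for i q using s t by (simp add: block_signs_def)
  show ?thesis
    unfolding complex_svd_def
  proof (intro conjI ballI)
    fix i assume "i \<in> {0..n}"
    then show "orthonormal_mat (c i) (U i * mat_diag (c i) (?e i))"
      using orthonormal_mat_scale_cols[OF U] e by simp
  next
    fix i assume i: "i \<in> {1..n}"
    then obtain j where j: "i = Suc j" "j \<in> {0..n}" by (cases i) auto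
    have i0: "i \<in> {0..n}" using i by simp
    have Uc: "U j \<in> carrier_mat (c j) (c j)" "U i \<in> carrier_mat (c i) (c i)"
      using U[OF j(2)] U[OF i0] unfolding orthonormal_mat_def by auto
    have Ai: "A i \<in> carrier_mat (c j) (c i)" using A[OF i] j by simp
    have \<Sigma>: "\<Sigma> i \<in> carrier_mat (r i) (r i)" "diagonal_mat (\<Sigma> i)"
      using svd i unfolding complex_svd_def by auto
    define F where "F = (\<lambda>(p, q). if q < r i \<and> p = r j + q then \<Sigma> i $$ (q, q) else 0)"
    have cj: "r j + r i + h j = c j" and ci: "r i + r (i + 1) + h i = c i"
      using c[OF j(2)] c[OF i0] j(1) by simp_all
    have nine: "nine_block_mat
          (0\<^sub>m (r (i - 1)) (r i)) (0\<^sub>m (r (i - 1)) (r (i + 1))) (0\<^sub>m (r (i - 1)) (h i))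
          (\<Sigma> i)                 (0\<^sub>m (r i) (r (i + 1)))       (0\<^sub>m (r i) (h i))
          (0\<^sub>m (h (i - 1)) (r i)) (0\<^sub>m (h (i - 1)) (r (i + 1))) (0\<^sub>m (h (i - 1)) (h i)) =
        mat (c j) (c i) F"
      unfolding nine_block_mat_eq[OF \<Sigma>] F_def using cj ci j(1) by simp
    have "transpose_mat (U (i - 1)) * A i * U i = mat (c j) (c i) F"
      unfolding nine[symmetric] using svd i unfolding complex_svd_def by blast
    then have "transpose_mat (U j) * A i * U i = mat (c j) (c i) F" using j(1) by simp
    from diag_congruence[OF Uc(1) Ai Uc(2) this, of "?e j" "?e i"]
    have "transpose_mat (U j * mat_diag (c j) (?e j)) * A i * (U i * mat_diag (c i) (?e i)) =
        mat (c j) (c i) (\<lambda>(p, q). ?e j p * F (p, q) * ?e i q)" .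
    also have "\<dots> = mat (c j) (c i) F"
    proof (rule cong_mat)
      fix p q
      \<comment> \<open>For \<open>q = 0\<close> both factors are \<open>s i\<close>, from the
        second block of \<open>U j\<close> and the first block of \<open>U i\<close>; for
        \<open>q > 0\<close> both are 1.\<close>
      have "?e j (r j + q) * ?e i q = 1" if "q < r i"
        using that s j(1) by (simp add: block_signs_def)
      then show "(case (p, q) of (p, q) \<Rightarrow> ?e j p * F (p, q) * ?e i q) = F (p, q)"
        by (auto simp: F_def)
    qed simp_all
    finally show "transpose_mat (U (i - 1) * mat_diag (c (i - 1)) (?e (i - 1))) * A i *
          (U i * mat_diag (c i) (?e i)) =
        nine_block_mat
          (0\<^sub>m (r (i - 1)) (r i)) (0\<^sub>m (r (i - 1)) (r (i + 1))) (0\<^sub>m (r (i - 1)) (h i))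
          (\<Sigma> i)                 (0\<^sub>m (r i) (r (i + 1)))       (0\<^sub>m (r i) (h i))
          (0\<^sub>m (h (i - 1)) (r i)) (0\<^sub>m (h (i - 1)) (r (i + 1))) (0\<^sub>m (h (i - 1)) (h i))"
      unfolding nine using j(1) by simp
  qed (use svd in \<open>auto simp: complex_svd_def\<close>)
qed

text \<open>The new determinant at \<open>i\<close> is \<open>d i * s i * s (i + 1) * t i\<close>.
  It becomes 1 by solving for \<open>s (i + 1)\<close> from left to right; \<open>t j\<close> is
  chosen so that the recursion returns to 1 at the right end. The diagonal matrices are
  kept.\<close>

lemma complex_svd_det_1:
  assumes svd: "complex_svd n c r h A U \<Sigma>"
    and A: "\<And>i. i \<in> {1..n} \<Longrightarrow> A i \<in> carrier_mat (c (i - 1)) (c i)"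
    and c: "\<And>i. i \<in> {0..n} \<Longrightarrow> c i = r i + r (i + 1) + h i"
    and r: "\<And>i. i \<in> {1..n} \<Longrightarrow> r i > 0" and j: "j \<in> {0..n}" "h j > 0"
  shows "\<exists>U. complex_svd n c r h A U \<Sigma> \<and> (\<forall>i\<in>{0..n}. det (U i) = 1)"
proof -
  \<comment> \<open>The default 1 above \<open>n\<close> lets \<open>d i * d i = 1\<close> hold at
    every index.\<close>
  define d where "d i = (if i \<le> n then det (U i) else 1)" for i
  define t where "t i = (if i = j then \<Prod>l\<le>n. d l else 1)" for i
  define s where "s i = (if i \<le> n then \<Prod>l<i. d l * t l else 1)" for i
  have U: "orthonormal_mat (c i) (U i)" if "i \<in> {0..n}" for i
    using svd that unfolding complex_svd_def by blast
  have d: "d i * d i = 1" for i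
    unfolding d_def using orthonormal_mat_det[OF U] by simp
  have prod1: "(\<Prod>l\<in>I. f l) * (\<Prod>l\<in>I. f l) = 1" if "\<And>l. f l * f l = 1" for f :: "nat \<Rightarrow> real" and I
    using that by (simp flip: prod.distrib)
  have t: "t i * t i = 1" for i unfolding t_def using prod1[of d, OF d] by simp
  have dt: "(d i * t i) * (d i * t i) = 1" for i
    using d[of i] t[of i] by (simp add: mult.assoc mult.left_commute)
  have s: "s i * s i = 1" for i unfolding s_def using prod1[of "\<lambda>l. d l * t l", OF dt] by simp
  have "(\<Prod>l<Suc n. t l) = (\<Prod>l\<le>n. d l)"
    unfolding t_def using j by simp
  then have all: "(\<Prod>l<Suc n. d l * t l) = 1"
    using prod1[of d, OF d] by (simp add: prod.distrib lessThan_Suc_atMost)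
  \<comment> \<open>At \<open>i = n\<close> the left side is the default value 1, and the right side
    is the total product, equal to 1 by \<open>all\<close>.\<close>
  have step: "s (i + 1) = s i * (d i * t i)" if "i \<le> n" for i
    using that all by (cases "i = n") (auto simp: s_def mult.commute)
  define V where "V i = U i * mat_diag (c i) (block_signs (r i) (r (i + 1)) (s i) (s (i + 1)) (t i))" for i
  have "complex_svd n c r h A V \<Sigma>"
    unfolding V_def by (rule complex_svd_change_signs[OF svd A c s t])
  moreover have "det (V i) = 1" if i: "i \<in> {0..n}" for i
  proof -
    have Uc: "U i \<in> carrier_mat (c i) (c i)" using U[OF i] unfolding orthonormal_mat_def by simp
    have "s 0 = 1" "s (n + 1) = 1" unfolding s_def by simp_all
    \<comment> \<open>Positive ranks confine empty pairing blocks to the two ends, where the sign is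
      1; and \<open>h i = 0\<close> excludes \<open>i = j\<close>, so \<open>t i = 1\<close>. No
      sign is lost in an empty block.\<close>
    moreover have "r i = 0 \<Longrightarrow> i = 0" "r (i + 1) = 0 \<Longrightarrow> i = n"
      using r[of i] r[of "i + 1"] i by fastforce+
    moreover have "h i = 0 \<Longrightarrow> t i = 1" unfolding t_def using j by auto
    ultimately have "(\<Prod>q<c i. block_signs (r i) (r (i + 1)) (s i) (s (i + 1)) (t i) q) = s i * s (i + 1) * t i"
      unfolding c[OF i] by (intro prod_block_signs) auto
    then have "det (V i) = d i * (s i * s (i + 1) * t i)"
      unfolding V_def using i Uc by (simp add: det_mult[of _ "c i"] det_mat_diag d_def)
    also have "\<dots> = (s i * s i) * ((d i * t i) * (d i * t i))"
      using step[of i] i by (simp add: algebra_simps)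
    finally show ?thesis using s dt by simp
  qed
  ultimately show ?thesis by blast
qed

theorem theorem1p1:
  fixes n :: nat and c r h :: "nat \<Rightarrow> nat" and A :: "nat \<Rightarrow> real mat"
  assumes "n \<ge> 1"
    and "\<And>i. i \<in> {1..n} \<Longrightarrow> A i \<in> carrier_mat (c (i - 1)) (c i)"
    and "\<And>i. i \<in> {1..n - 1} \<Longrightarrow> A i * A (i + 1) = 0\<^sub>m (c (i - 1)) (c (i + 1))"
    and "\<And>i. i \<in> {1..n} \<Longrightarrow> r i = mat_rank (A i)"
    and "r 0 = 0" and "r (n + 1) = 0"
    and "\<And>i. i \<in> {0..n} \<Longrightarrow> h i = c i - (r i + r (i + 1))"
  shows "(\<exists>U \<Sigma>. complex_svd n c r h A U \<Sigma>) \<and>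
    ((\<forall>i\<in>{1..n}. r i > 0) \<and> (\<exists>i\<in>{0..n}. h i > 0) \<longrightarrow>
      (\<exists>U \<Sigma>. complex_svd n c r h A U \<Sigma> \<and> (\<forall>i\<in>{0..n}. det (U i) = 1)))"
proof (intro conjI impI)
  obtain U \<Sigma> where svd: "complex_svd n c r h A U \<Sigma>"
    using complex_svd_ex(1)[of n A c r h] assms(2-7) by blast
  then show "\<exists>U \<Sigma>. complex_svd n c r h A U \<Sigma>" by blast
  have c: "c i = r i + r (i + 1) + h i" if "i \<in> {0..n}" for i
    using complex_svd_ex(2)[OF assms(2-7) that] assms(7)[OF that] by simp
  assume "(\<forall>i\<in>{1..n}. r i > 0) \<and> (\<exists>i\<in>{0..n}. h i > 0)"
  then show "\<exists>U \<Sigma>. complex_svd n c r h A U \<Sigma> \<and> (\<forall>i\<in>{0..n}. det (U i) = 1)"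
    using complex_svd_det_1[OF svd assms(2) c] by blast
qed

end
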